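(* Let $\mathcal{M}=(\Phi,\mathcal{W},C,P)$ be a many-to-one matching market in which every firm has a path-independent choice function satisfying the Law of Aggregate Demand, and let $M$ be an associated one-to-one market obtained from an Aizerman–Malishevski decomposition of the firms' choice functions. Then the number of matched firm-copies of a firm is the same in every stable* matching: for every firm $\varphi_i\in\Phi$ and all stable* matchings $\lambda,\lambda'$ of $M$, $$|\{j\in J_i:\lambda(f_{ij})\neq\emptyset\}|=|\{j\in J_i:\lambda'(f_{ij})\neq\emptyset\}|.$$
   Context: **Many-to-one market.** $\Phi=\{\varphi_1,\dots,\varphi_n\}$ is a finite set of firms, $I=\{1,\dots,n\}$, and $\mathcal{W}$ is a finite set of workers. Each firm $\varphi$ has a choice function $C_\varphi:2^{\mathcal{W}}\to 2^{\mathcal{W}}$ with $C_\varphi(W)\subseteq W$ for all $W\subseteq\mathcal{W}$. It is path-independent if $C_\varphi(W\cup W')=C_\varphi(C_\varphi(W)\cup W')$ for all $W,W'\subseteq\mathcal{W}$. It satisfies the Law of Aggregate Demand if $W''\subseteq W'\subseteq\mathcal{W}$ implies $|C_\varphi(W'')|\le|C_\varphi(W')|$. Each worker $w$ has a strict linear order $P_w$ on $\Phi\cup\{\emptyset\}$, where $\emptyset$ stands for being unmatched. **Aizerman–Malishevski decomposition.** For firm $\varphi_i$ this is a finite sequence $(P_{ij})_{j\in J_i}$, $J_i=\{1,\dots,|J_i|\}$, of strict linear orders on $\mathcal{W}\cup\{\emptyset\}$ such that $C_{\varphi_i}(S)=\bigcup_{j\in J_i}\max_S P_{ij}$ for all $S\subseteq\mathcal{W}$.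 Here $\max_S P_{ij}$ is the singleton of the $P_{ij}$-best worker of $S$ if that worker is preferred to $\emptyset$, and is empty if no worker in $S$ is preferred to $\emptyset$. Such a sequence exists if and only if $C_{\varphi_i}$ is path-independent. **Associated one-to-one market $M$.** The firm-copies are $\mathcal{F}=\{f_{ij}: i\in I, j\in J_i\}$; copy $f_{ij}$ (a copy of firm $\varphi_i$) has preference $P_{ij}$. Each worker $w$ has a strict linear order $\overline{P}_w$ on $\mathcal{F}\cup\{\emptyset\}$ such that: (1) $\varphi_iP_w\varphi_{i'}$ implies $f_{ij}\overline{P}_wf_{i'j'}$ for all $j\in J_i$, $j'\in J_{i'}$, and likewise each $f_{ij}$ is on the same side of $\emptyset$ in $\overline{P}_w$ as $\varphi_i$ is in $P_w$; (2) $f_{ij}\overline{P}_wf_{ij'}$ if and only if $j<j'$. A matching of $M$ is a map $\lambda:\mathcal{F}\cup\mathcal{W}\to\mathcal{F}\cup\mathcal{W}\cup\{\emptyset\}$ with $\lambda(f)\in\mathcal{W}\cup\{\emptyset\}$, $\lambda(w)\in\mathcal{F}\cup\{\emptyset\}$, and $\lambda(f)=w\iff\lambda(w)=f$. **Stability*.** $\lambda$ is blocked* by a worker $w$ if $\emptyset\,\overline{P}_w\,\lambda(w)$. It is blocked* by a firm-copy $f_{ij}$ if either $\emptyset P_{ij}\lambda(f_{ij})$, or $\lambda(f_{ij})\neq\emptyset$ and there is $j'\in J_i$ with $\lambda(f_{ij'})P_{ij}\lambda(f_{ij})$. It is blocked* by a pair $(f_{ij},w)$ if $f_{ij}\overline{P}_w\lambda(w)$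 and $wP_{ij}\lambda(f_{ij'})$ for each $j'\in J_i$. $\lambda$ is stable* if it is not blocked* by any worker, any firm-copy, or any pair (firm-copy, worker). *)

theory Defs
  imports Main
begin

text \<open>
  A preference is a set of pairs, with \<open>(x, y) \<in> r\<close> meaning that \<open>x\<close> is strictly preferred to \<open>y\<close>.
  The outside option is \<open>None\<close>. The inclusion makes \<open>r\<close> a relation on the carrier itself.
\<close>

definition strict_preference_on :: "'a set \<Rightarrow> 'a option rel \<Rightarrow> bool" where
  "strict_preference_on A r \<longleftrightarrow>
     r \<subseteq> (Some ` A \<union> {None}) \<times> (Some ` A \<union> {None}) \<and>
     strict_linear_order_on (Some ` A \<union> {None}) r"

definition choice_function :: "'w set \<Rightarrow> ('w set \<Rightarrow> 'w set) \<Rightarrow> bool" where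
  "choice_function W c \<longleftrightarrow> (\<forall>S. S \<subseteq> W \<longrightarrow> c S \<subseteq> S)"

definition path_independent :: "'w set \<Rightarrow> ('w set \<Rightarrow> 'w set) \<Rightarrow> bool" where
  "path_independent W c \<longleftrightarrow>
     (\<forall>S T. S \<subseteq> W \<longrightarrow> T \<subseteq> W \<longrightarrow> c (S \<union> T) = c (c S \<union> T))"

definition law_of_aggregate_demand :: "'w set \<Rightarrow> ('w set \<Rightarrow> 'w set) \<Rightarrow> bool" where
  "law_of_aggregate_demand W c \<longleftrightarrow>
     (\<forall>S T. T \<subseteq> S \<longrightarrow> S \<subseteq> W \<longrightarrow> card (c T) \<le> card (c S))"

definition many_to_one_market ::
  "'f set \<Rightarrow> 'w set \<Rightarrow> ('f \<Rightarrow> 'w set \<Rightarrow> 'w set) \<Rightarrow> ('w \<Rightarrow> 'f option rel) \<Rightarrow> bool" where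
  "many_to_one_market \<Phi> W C P \<longleftrightarrow>
     finite \<Phi> \<and> finite W \<and>
     (\<forall>\<phi>\<in>\<Phi>. choice_function W (C \<phi>)) \<and>
     (\<forall>w\<in>W. strict_preference_on \<Phi> (P w))"

definition max_of :: "'w set \<Rightarrow> 'w option rel \<Rightarrow> 'w set" where
  "max_of S r =
     {w \<in> S. (\<forall>w'\<in>S. w' \<noteq> w \<longrightarrow> (Some w, Some w') \<in> r) \<and> (Some w, None) \<in> r}"

text \<open>The sequence of orders is \<open>Q 1, \<dots>, Q k\<close>; values of \<open>Q\<close> at other indices are irrelevant.\<close>

definition AM_decomposition ::
  "'w set \<Rightarrow> ('w set \<Rightarrow> 'w set) \<Rightarrow> nat \<Rightarrow> (nat \<Rightarrow> 'w option rel) \<Rightarrow> bool" where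
  "AM_decomposition W c k Q \<longleftrightarrow>
     (\<forall>j\<in>{1..k}. strict_preference_on W (Q j)) \<and>
     (\<forall>S. S \<subseteq> W \<longrightarrow> c S = (\<Union>j\<in>{1..k}. max_of S (Q j)))"

text \<open>The copy with index \<open>j\<close> of the firm \<open>\<phi>\<close> is the pair \<open>(\<phi>, j)\<close>.\<close>

type_synonym 'f copy = "'f \<times> nat"

definition firm_copies :: "'f set \<Rightarrow> ('f \<Rightarrow> nat) \<Rightarrow> 'f copy set" where
  "firm_copies \<Phi> k = (SIGMA \<phi>:\<Phi>. {1..k \<phi>})"

definition extends_preference ::
  "'f set \<Rightarrow> ('f \<Rightarrow> nat) \<Rightarrow> 'f option rel \<Rightarrow> 'f copy option rel \<Rightarrow> bool" where
  "extends_preference \<Phi> k p q \<longleftrightarrow>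
     strict_preference_on (firm_copies \<Phi> k) q \<and>
     (\<forall>\<phi>\<in>\<Phi>. \<forall>\<psi>\<in>\<Phi>. (Some \<phi>, Some \<psi>) \<in> p \<longrightarrow>
        (\<forall>j\<in>{1..k \<phi>}. \<forall>j'\<in>{1..k \<psi>}. (Some (\<phi>, j), Some (\<psi>, j')) \<in> q)) \<and>
     (\<forall>\<phi>\<in>\<Phi>. \<forall>j\<in>{1..k \<phi>}.
        ((Some (\<phi>, j), None) \<in> q \<longleftrightarrow> (Some \<phi>, None) \<in> p) \<and>
        ((None, Some (\<phi>, j)) \<in> q \<longleftrightarrow> (None, Some \<phi>) \<in> p)) \<and>
     (\<forall>\<phi>\<in>\<Phi>. \<forall>j\<in>{1..k \<phi>}. \<forall>j'\<in>{1..k \<phi>}.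
        (Some (\<phi>, j), Some (\<phi>, j')) \<in> q \<longleftrightarrow> j < j')"

definition associated_market ::
  "'f set \<Rightarrow> 'w set \<Rightarrow> ('f \<Rightarrow> 'w set \<Rightarrow> 'w set) \<Rightarrow> ('w \<Rightarrow> 'f option rel) \<Rightarrow>
   ('f \<Rightarrow> nat) \<Rightarrow> ('f \<Rightarrow> nat \<Rightarrow> 'w option rel) \<Rightarrow> ('w \<Rightarrow> 'f copy option rel) \<Rightarrow> bool" where
  "associated_market \<Phi> W C P k Q Pbar \<longleftrightarrow>
     (\<forall>\<phi>\<in>\<Phi>. AM_decomposition W (C \<phi>) (k \<phi>) (Q \<phi>)) \<and>
     (\<forall>w\<in>W. extends_preference \<Phi> k (P w) (Pbar w))"

text \<open>
  A matching, a map on the disjoint union of copies and workers, is given by its two restrictions.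
  Only its values on \<open>firm_copies \<Phi> k\<close> and \<open>W\<close> matter.
\<close>

record ('f, 'w) matching =
  worker_of :: "'f copy \<Rightarrow> 'w option"
  copy_of :: "'w \<Rightarrow> 'f copy option"

definition is_matching :: "'f set \<Rightarrow> 'w set \<Rightarrow> ('f \<Rightarrow> nat) \<Rightarrow> ('f, 'w) matching \<Rightarrow> bool" where
  "is_matching \<Phi> W k \<mu> \<longleftrightarrow>
     (\<forall>f\<in>firm_copies \<Phi> k. worker_of \<mu> f \<in> Some ` W \<union> {None}) \<and>
     (\<forall>w\<in>W. copy_of \<mu> w \<in> Some ` firm_copies \<Phi> k \<union> {None}) \<and>
     (\<forall>f\<in>firm_copies \<Phi> k. \<forall>w\<in>W. worker_of \<mu> f = Some w \<longleftrightarrow> copy_of \<mu> w = Some f)"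

definition blocked_by_worker ::
  "('w \<Rightarrow> 'f copy option rel) \<Rightarrow> ('f, 'w) matching \<Rightarrow> 'w \<Rightarrow> bool" where
  "blocked_by_worker Pbar \<mu> w \<longleftrightarrow> (None, copy_of \<mu> w) \<in> Pbar w"

definition blocked_by_copy ::
  "('f \<Rightarrow> nat) \<Rightarrow> ('f \<Rightarrow> nat \<Rightarrow> 'w option rel) \<Rightarrow> ('f, 'w) matching \<Rightarrow> 'f \<Rightarrow> nat \<Rightarrow> bool" where
  "blocked_by_copy k Q \<mu> \<phi> j \<longleftrightarrow>
     (None, worker_of \<mu> (\<phi>, j)) \<in> Q \<phi> j \<or>
     (worker_of \<mu> (\<phi>, j) \<noteq> None \<and>
      (\<exists>j'\<in>{1..k \<phi>}. (worker_of \<mu> (\<phi>, j'), worker_of \<mu> (\<phi>, j)) \<in> Q \<phi> j))"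

definition blocked_by_pair ::
  "('f \<Rightarrow> nat) \<Rightarrow> ('f \<Rightarrow> nat \<Rightarrow> 'w option rel) \<Rightarrow> ('w \<Rightarrow> 'f copy option rel) \<Rightarrow>
   ('f, 'w) matching \<Rightarrow> 'f \<Rightarrow> nat \<Rightarrow> 'w \<Rightarrow> bool" where
  "blocked_by_pair k Q Pbar \<mu> \<phi> j w \<longleftrightarrow>
     (Some (\<phi>, j), copy_of \<mu> w) \<in> Pbar w \<and>
     (\<forall>j'\<in>{1..k \<phi>}. (Some w, worker_of \<mu> (\<phi>, j')) \<in> Q \<phi> j)"

definition stable_star ::
  "'f set \<Rightarrow> 'w set \<Rightarrow> ('f \<Rightarrow> nat) \<Rightarrow> ('f \<Rightarrow> nat \<Rightarrow> 'w option rel) \<Rightarrow>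
   ('w \<Rightarrow> 'f copy option rel) \<Rightarrow> ('f, 'w) matching \<Rightarrow> bool" where
  "stable_star \<Phi> W k Q Pbar \<mu> \<longleftrightarrow>
     is_matching \<Phi> W k \<mu> \<and>
     (\<forall>w\<in>W. \<not> blocked_by_worker Pbar \<mu> w) \<and>
     (\<forall>\<phi>\<in>\<Phi>. \<forall>j\<in>{1..k \<phi>}. \<not> blocked_by_copy k Q \<mu> \<phi> j) \<and>
     (\<forall>\<phi>\<in>\<Phi>. \<forall>j\<in>{1..k \<phi>}. \<forall>w\<in>W. \<not> blocked_by_pair k Q Pbar \<mu> \<phi> j w)"

end

theory Submission
  imports Defs
begin

text \<open>
  Let \<open>A \<phi>\<close> and \<open>A' \<phi>\<close> be the sets of workers assigned to the copies of \<open>\<phi>\<close> by two stable* matchings,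
  and \<open>B \<phi> = C \<phi> (A \<phi> \<union> A' \<phi>)\<close>. A worker of \<open>B \<phi>\<close> who is in \<open>A \<phi>\<close> is matched in the other
  matching too, to a firm that she likes at least as much as \<open>\<phi>\<close>, since otherwise she and a copy of
  \<open>\<phi>\<close> would block it. Hence the sets \<open>B \<phi>\<close> are pairwise disjoint and contained in the set of workers
  matched in either matching, so that \<open>(\<Sum>\<phi>. |B \<phi>|) \<le> (\<Sum>\<phi>. |A \<phi>|)\<close>. As \<open>C \<phi> (A \<phi>) = A \<phi>\<close>, the Law of
  Aggregate Demand gives \<open>|A \<phi>| \<le> |B \<phi>|\<close> for every \<open>\<phi>\<close>, and therefore \<open>|A \<phi>| = |B \<phi>| = |A' \<phi>|\<close>.
\<close>

definition assigned :: "('f \<Rightarrow> nat) \<Rightarrow> ('f, 'w) matching \<Rightarrow> 'f \<Rightarrow> 'w set" where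
  "assigned k \<mu> \<phi> = {w. \<exists>j\<in>{1..k \<phi>}. worker_of \<mu> (\<phi>, j) = Some w}"

lemma strict_preference_on_asym:
  assumes "strict_preference_on A r" "(x, y) \<in> r"
  shows "(y, x) \<notin> r"
  using assms
  unfolding strict_preference_on_def strict_linear_order_on_def irrefl_def trans_def by blast

lemma strict_preference_on_total:
  assumes "strict_preference_on A r" "x \<in> Some ` A \<union> {None}" "y \<in> Some ` A \<union> {None}"
    and "x \<noteq> y" "(x, y) \<notin> r"
  shows "(y, x) \<in> r"
  using assms unfolding strict_preference_on_def strict_linear_order_on_def total_on_def by blast

lemma is_matching_worker_copy:
  assumes "is_matching \<Phi> W k \<mu>" "\<phi> \<in> \<Phi>" "j \<in> {1..k \<phi>}" "worker_of \<mu> (\<phi>, j) = Some w"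
  shows "w \<in> W" "copy_of \<mu> w = Some (\<phi>, j)"
proof -
  have f: "(\<phi>, j) \<in> firm_copies \<Phi> k"
    using assms by (simp add: firm_copies_def)
  then have "worker_of \<mu> (\<phi>, j) \<in> Some ` W \<union> {None}"
    using assms(1) unfolding is_matching_def by blast
  then show w: "w \<in> W"
    using assms(4) by auto
  show "copy_of \<mu> w = Some (\<phi>, j)"
    using assms(1,4) f w unfolding is_matching_def by blast
qed

lemma is_matching_copy_worker:
  assumes "is_matching \<Phi> W k \<mu>" "w \<in> W" "copy_of \<mu> w = Some (\<phi>, j)"
  shows "\<phi> \<in> \<Phi>" "j \<in> {1..k \<phi>}" "worker_of \<mu> (\<phi>, j) = Some w"
proof -
  have "copy_of \<mu> w \<in> Some ` firm_copies \<Phi> k \<union> {None}"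
    using assms(1,2) unfolding is_matching_def by blast
  then have f: "(\<phi>, j) \<in> firm_copies \<Phi> k"
    using assms(3) by auto
  then show "\<phi> \<in> \<Phi>" "j \<in> {1..k \<phi>}"
    by (auto simp: firm_copies_def)
  show "worker_of \<mu> (\<phi>, j) = Some w"
    using assms f unfolding is_matching_def by blast
qed

lemma assigned_subset:
  assumes "is_matching \<Phi> W k \<mu>" "\<phi> \<in> \<Phi>"
  shows "assigned k \<mu> \<phi> \<subseteq> W"
  using is_matching_worker_copy(1)[OF assms] by (auto simp: assigned_def)

lemma assigned_unique:
  assumes "is_matching \<Phi> W k \<mu>" "\<phi> \<in> \<Phi>" "\<psi> \<in> \<Phi>"
    and "w \<in> assigned k \<mu> \<phi>" "w \<in> assigned k \<mu> \<psi>"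
  shows "\<phi> = \<psi>"
proof -
  obtain i j where "copy_of \<mu> w = Some (\<phi>, i)" "copy_of \<mu> w = Some (\<psi>, j)"
    using assms(4,5) is_matching_worker_copy(2)[OF assms(1)] assms(2,3)
    unfolding assigned_def by blast
  then show ?thesis
    by simp
qed

text \<open>The copy held by a worker is recovered from the worker through \<open>copy_of\<close>,
  so no worker is counted twice. This turns the count of copies in the theorem into the size of a
  set of workers, to which the choice function applies.\<close>

lemma card_matched_copies:
  assumes "is_matching \<Phi> W k \<mu>" "\<phi> \<in> \<Phi>"
  shows "card {j \<in> {1..k \<phi>}. worker_of \<mu> (\<phi>, j) \<noteq> None} = card (assigned k \<mu> \<phi>)"
proof (rule bij_betw_same_card)
  let ?J = "{j \<in> {1..k \<phi>}. worker_of \<mu> (\<phi>, j) \<noteq> None}"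
  let ?g = "\<lambda>j. the (worker_of \<mu> (\<phi>, j))"
  have "copy_of \<mu> (?g j) = Some (\<phi>, j)" if "j \<in> ?J" for j
    using that is_matching_worker_copy(2)[OF assms] by auto
  then have "inj_on ?g ?J"
    by (metis (mono_tags, lifting) inj_onI option.inject prod.inject)
  moreover have "?g ` ?J = assigned k \<mu> \<phi>"
    by (force simp: assigned_def image_iff)
  ultimately show "bij_betw ?g ?J (assigned k \<mu> \<phi>)"
    by (simp add: bij_betw_def)
qed

text \<open>A stable* firm-copy envies none of its sibling copies. Hence the worker it holds is the
  best, for its own order, of all workers held by the firm, and every assigned worker is the maximum
  for the copy holding that worker. The other inclusion is immediate, since \<open>max_of\<close>
  only picks from its set.\<close>

lemma choice_assigned:
  assumes m: "is_matching \<Phi> W k \<mu>" and "\<phi> \<in> \<Phi>"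
    and nb: "\<And>j. j \<in> {1..k \<phi>} \<Longrightarrow> \<not> blocked_by_copy k Q \<mu> \<phi> j"
    and am: "AM_decomposition W c (k \<phi>) (Q \<phi>)"
  shows "c (assigned k \<mu> \<phi>) = assigned k \<mu> \<phi>" (is "c ?A = ?A")
proof -
  have sub: "?A \<subseteq> W"
    by (rule assigned_subset[OF assms(1,2)])
  have "w \<in> (\<Union>j\<in>{1..k \<phi>}. max_of ?A (Q \<phi> j))" if w: "w \<in> ?A" for w
  proof -
    obtain j where j: "j \<in> {1..k \<phi>}" and jw: "worker_of \<mu> (\<phi>, j) = Some w"
      using w by (auto simp: assigned_def)
    have sp: "strict_preference_on W (Q \<phi> j)"
      using am j by (simp add: AM_decomposition_def)
    have best: "(Some w, Some v) \<in> Q \<phi> j" if v: "v \<in> ?A" "v \<noteq> w" for v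
    proof -
      obtain i where "i \<in> {1..k \<phi>}" "worker_of \<mu> (\<phi>, i) = Some v"
        using v(1) by (auto simp: assigned_def)
      then have "(Some v, Some w) \<notin> Q \<phi> j"
        using nb[OF j] jw by (metis blocked_by_copy_def option.distinct(1))
      moreover have "Some v \<in> Some ` W \<union> {None}" "Some w \<in> Some ` W \<union> {None}"
        using v(1) w sub by auto
      ultimately show ?thesis
        using strict_preference_on_total[OF sp] v(2) by simp
    qed
    have "(None, Some w) \<notin> Q \<phi> j"
      using nb[OF j] jw by (simp add: blocked_by_copy_def)
    then have "(Some w, None) \<in> Q \<phi> j"
      using strict_preference_on_total[OF sp, of None "Some w"] w sub by auto
    then have "w \<in> max_of ?A (Q \<phi> j)"
      using best w by (simp add: max_of_def)
    then show ?thesis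
      using j by blast
  qed
  then show ?thesis
    using am sub by (auto simp: AM_decomposition_def max_of_def)
qed

lemma assigned_acceptable:
  assumes st: "stable_star \<Phi> W k Q Pbar \<mu>" and "\<phi> \<in> \<Phi>" and w: "w \<in> assigned k \<mu> \<phi>"
    and ext: "extends_preference \<Phi> k (P w) (Pbar w)"
  shows "(Some \<phi>, None) \<in> P w"
proof -
  obtain j where j: "j \<in> {1..k \<phi>}" and jw: "worker_of \<mu> (\<phi>, j) = Some w"
    using w by (auto simp: assigned_def)
  have "w \<in> W" "copy_of \<mu> w = Some (\<phi>, j)"
    using is_matching_worker_copy[of \<Phi> W k \<mu>, OF _ assms(2) j jw] st
    by (auto simp: stable_star_def)
  then have "(None, Some (\<phi>, j)) \<notin> Pbar w"
    using st by (auto simp: stable_star_def blocked_by_worker_def)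
  moreover have "strict_preference_on (firm_copies \<Phi> k) (Pbar w)"
    using ext by (simp add: extends_preference_def)
  ultimately have "(Some (\<phi>, j), None) \<in> Pbar w"
    using strict_preference_on_total[of "firm_copies \<Phi> k" "Pbar w" None "Some (\<phi>, j)"] j assms(2)
    by (simp add: firm_copies_def)
  then show ?thesis
    using ext j assms(2) by (simp add: extends_preference_def)
qed

lemma chosen_weakly_prefers_assignment:
  assumes st: "stable_star \<Phi> W k Q Pbar \<mu>" and "\<phi> \<in> \<Phi>" "w \<in> W"
    and am: "AM_decomposition W c (k \<phi>) (Q \<phi>)"
    and ext: "extends_preference \<Phi> k (P w) (Pbar w)"
    and sp: "strict_preference_on \<Phi> (P w)"
    and acc: "(Some \<phi>, None) \<in> P w"
    and S: "assigned k \<mu> \<phi> \<subseteq> S" "S \<subseteq> W" and w: "w \<in> c S"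
  shows "\<exists>\<psi>\<in>\<Phi>. w \<in> assigned k \<mu> \<psi> \<and> (\<psi> = \<phi> \<or> (Some \<psi>, Some \<phi>) \<in> P w)"
proof (cases "w \<in> assigned k \<mu> \<phi>")
  case True
  then show ?thesis
    using assms(2) by blast
next
  case False
  have m: "is_matching \<Phi> W k \<mu>"
    using st by (simp add: stable_star_def)
  obtain j where j: "j \<in> {1..k \<phi>}" and jw: "w \<in> max_of S (Q \<phi> j)"
    using am w S(2) by (auto simp: AM_decomposition_def)
  \<comment> \<open>This is the firm's half of a blocking* pair. An empty copy is beaten because a
    maximum is preferred to \<open>None\<close>, an occupied one because its worker lies in
    \<open>S\<close> and differs from \<open>w\<close>.\<close>
  have "(Some w, worker_of \<mu> (\<phi>, i)) \<in> Q \<phi> j" if "i \<in> {1..k \<phi>}" for i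
  proof (cases "worker_of \<mu> (\<phi>, i)")
    case None
    then show ?thesis
      using jw by (simp add: max_of_def)
  next
    case (Some v)
    then have "v \<in> assigned k \<mu> \<phi>"
      using that by (auto simp: assigned_def)
    then show ?thesis
      using jw Some S(1) False by (auto simp: max_of_def)
  qed
  then have nb: "(Some (\<phi>, j), copy_of \<mu> w) \<notin> Pbar w"
    using st assms(2,3) j unfolding stable_star_def blocked_by_pair_def by blast
  moreover have "(Some (\<phi>, j), None) \<in> Pbar w"
    using ext acc assms(2) j by (simp add: extends_preference_def)
  ultimately obtain \<psi> i where c: "copy_of \<mu> w = Some (\<psi>, i)"
    by (cases "copy_of \<mu> w") auto
  note \<psi> = is_matching_copy_worker[OF m assms(3) c]
  then have \<psi>w: "w \<in> assigned k \<mu> \<psi>"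
    by (auto simp: assigned_def)
  \<comment> \<open>Otherwise every copy of \<open>\<phi>\<close> would precede every copy of
    \<open>\<psi>\<close> in \<open>Pbar w\<close>, against \<open>nb\<close>.\<close>
  have "(Some \<phi>, Some \<psi>) \<notin> P w"
    using nb c ext j \<psi> assms(2) unfolding extends_preference_def by auto
  moreover have "\<phi> \<noteq> \<psi>"
    using False \<psi>w by blast
  ultimately have "(Some \<psi>, Some \<phi>) \<in> P w"
    using strict_preference_on_total[OF sp] assms(2) \<psi>(1) by blast
  then show ?thesis
    using \<psi>(1) \<psi>w by blast
qed

text \<open>One strict inequality would make the sums strictly ordered. This passes from a count
  over all firms to each single firm.\<close>

lemma sum_le_imp_pointwise_eq:
  fixes f g :: "'a \<Rightarrow> nat"
  assumes "finite A" "\<And>x. x \<in> A \<Longrightarrow> f x \<le> g x" "sum g A \<le> sum f A" "x \<in> A"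
  shows "f x = g x"
proof (rule ccontr)
  assume "f x \<noteq> g x"
  then have "\<exists>x\<in>A. f x < g x"
    using assms(2,4) le_neq_implies_less by blast
  then have "sum f A < sum g A"
    using assms(1,2) by (intro sum_strict_mono_ex1) auto
  then show False
    using assms(3) by simp
qed

theorem theorem4:
  fixes \<Phi> :: "'f set" and W :: "'w set"
    and C :: "'f \<Rightarrow> 'w set \<Rightarrow> 'w set"
    and P :: "'w \<Rightarrow> 'f option rel"
    and k :: "'f \<Rightarrow> nat"
    and Q :: "'f \<Rightarrow> nat \<Rightarrow> 'w option rel"
    and Pbar :: "'w \<Rightarrow> 'f copy option rel"
    and \<mu> \<mu>' :: "('f, 'w) matching"
    and \<phi> :: 'f
  assumes "many_to_one_market \<Phi> W C P"
    and "\<forall>\<psi>\<in>\<Phi>. path_independent W (C \<psi>)"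
    and "\<forall>\<psi>\<in>\<Phi>. law_of_aggregate_demand W (C \<psi>)"
    and "associated_market \<Phi> W C P k Q Pbar"
    and "\<phi> \<in> \<Phi>"
    and "stable_star \<Phi> W k Q Pbar \<mu>"
    and "stable_star \<Phi> W k Q Pbar \<mu>'"
  shows "card {j \<in> {1..k \<phi>}. worker_of \<mu> (\<phi>, j) \<noteq> None} =
         card {j \<in> {1..k \<phi>}. worker_of \<mu>' (\<phi>, j) \<noteq> None}"
proof -
  let ?A = "assigned k \<mu>" and ?A' = "assigned k \<mu>'"
  define B where "B \<psi> = C \<psi> (?A \<psi> \<union> ?A' \<psi>)" for \<psi>
  have fin: "finite \<Phi>" "finite W"
    and sp: "\<And>w. w \<in> W \<Longrightarrow> strict_preference_on \<Phi> (P w)"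
    and cf: "\<And>\<psi>. \<psi> \<in> \<Phi> \<Longrightarrow> choice_function W (C \<psi>)"
    using assms(1) by (auto simp: many_to_one_market_def)
  have am: "\<And>\<psi>. \<psi> \<in> \<Phi> \<Longrightarrow> AM_decomposition W (C \<psi>) (k \<psi>) (Q \<psi>)"
    and ext: "\<And>w. w \<in> W \<Longrightarrow> extends_preference \<Phi> k (P w) (Pbar w)"
    using assms(4) by (auto simp: associated_market_def)
  have m: "is_matching \<Phi> W k \<mu>" "is_matching \<Phi> W k \<mu>'"
    using assms(6,7) by (auto simp: stable_star_def)
  have sub: "?A \<psi> \<union> ?A' \<psi> \<subseteq> W" if "\<psi> \<in> \<Phi>" for \<psi>
    using assigned_subset[OF m(1) that] assigned_subset[OF m(2) that] by simp
  have B_sub: "B \<psi> \<subseteq> ?A \<psi> \<union> ?A' \<psi>" if "\<psi> \<in> \<Phi>" for \<psi>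
    using cf[OF that] sub[OF that] by (auto simp: B_def choice_function_def)
  have acc: "(Some \<psi>, None) \<in> P w" if "\<psi> \<in> \<Phi>" "w \<in> B \<psi>" for \<psi> w
  proof -
    have "w \<in> ?A \<psi> \<or> w \<in> ?A' \<psi>" "w \<in> W"
      using B_sub[OF that(1)] sub[OF that(1)] that(2) by auto
    then show ?thesis
      using assigned_acceptable[OF assms(6) that(1)] assigned_acceptable[OF assms(7) that(1)] ext
      by blast
  qed
  have weak: "\<exists>\<chi>\<in>\<Phi>. w \<in> assigned k \<nu> \<chi> \<and> (\<chi> = \<psi> \<or> (Some \<chi>, Some \<psi>) \<in> P w)"
    if "\<psi> \<in> \<Phi>" "w \<in> B \<psi>" "\<nu> = \<mu> \<or> \<nu> = \<mu>'" for \<psi> w \<nu>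
  proof (rule chosen_weakly_prefers_assignment[where c = "C \<psi>" and S = "?A \<psi> \<union> ?A' \<psi>"])
    show "w \<in> W"
      using B_sub[OF that(1)] sub[OF that(1)] that(2) by blast
    then show "extends_preference \<Phi> k (P w) (Pbar w)" "strict_preference_on \<Phi> (P w)"
      using ext sp by auto
    show "stable_star \<Phi> W k Q Pbar \<nu>"
      using that assms(6,7) by auto
    show "w \<in> C \<psi> (?A \<psi> \<union> ?A' \<psi>)"
      using that by (simp add: B_def)
    show "assigned k \<nu> \<psi> \<subseteq> ?A \<psi> \<union> ?A' \<psi>"
      using that by auto
  qed (use that(1) am acc[OF that(1,2)] sub[OF that(1)] in auto)
  have disj: "\<psi> = \<chi>" if "\<psi> \<in> \<Phi>" "\<chi> \<in> \<Phi>" "w \<in> B \<psi>" "w \<in> B \<chi>" for \<psi> \<chi> w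
  proof (rule ccontr)
    assume ne: "\<psi> \<noteq> \<chi>"
    \<comment> \<open>The firm provided by \<open>weak\<close> must be \<open>\<chi>'\<close>, the
      only firm holding \<open>w\<close> in \<open>\<nu>\<close>; as it differs from
      \<open>\<psi>'\<close>, the preference is strict.\<close>
    have prefers: "(Some \<chi>', Some \<psi>') \<in> P w"
      if "\<psi>' \<in> \<Phi>" "\<chi>' \<in> \<Phi>" "w \<in> B \<psi>'" "\<psi>' \<noteq> \<chi>'" "\<nu> = \<mu> \<or> \<nu> = \<mu>'" "w \<in> assigned k \<nu> \<chi>'"
      for \<psi>' \<chi>' \<nu>
    proof -
      have "is_matching \<Phi> W k \<nu>"
        using m that(5) by auto
      with weak[OF that(1,3,5)] show ?thesis
        using assigned_unique that(2,4,6) by metis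
    qed
    \<comment> \<open>A single matching cannot place \<open>w\<close> at both firms, so each
      matching accounts for one of them. Applying \<open>prefers\<close> once in each matching then
      gives opposite strict preferences.\<close>
    have "w \<in> ?A \<psi> \<and> w \<in> ?A' \<chi> \<or> w \<in> ?A' \<psi> \<and> w \<in> ?A \<chi>"
      using assigned_unique[OF m(1) that(1,2)] assigned_unique[OF m(2) that(1,2)]
        B_sub[OF that(1)] B_sub[OF that(2)] ne that(3,4) by blast
    then have "(Some \<chi>, Some \<psi>) \<in> P w \<and> (Some \<psi>, Some \<chi>) \<in> P w"
      using prefers that ne by metis
    moreover have "w \<in> W"
      using B_sub[OF that(1)] sub[OF that(1)] that(3) by blast
    ultimately show False
      using strict_preference_on_asym[OF sp] by blast
  qed
  have eq: "card (assigned k \<nu> \<phi>) = card (B \<phi>)" if \<nu>: "\<nu> = \<mu> \<or> \<nu> = \<mu>'" for \<nu>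
  proof (rule sum_le_imp_pointwise_eq[OF fin(1)])
    have m\<nu>: "is_matching \<Phi> W k \<nu>"
      using \<nu> m by auto
    have finA: "finite (assigned k \<nu> \<psi>)" "finite (B \<psi>)" if "\<psi> \<in> \<Phi>" for \<psi>
      using \<nu> sub[OF that] B_sub[OF that] fin(2) by (auto dest: finite_subset)
    show "card (assigned k \<nu> \<psi>) \<le> card (B \<psi>)" if \<psi>: "\<psi> \<in> \<Phi>" for \<psi>
    proof -
      have "\<And>j. j \<in> {1..k \<psi>} \<Longrightarrow> \<not> blocked_by_copy k Q \<nu> \<psi> j"
        using \<nu> assms(6,7) \<psi> by (auto simp: stable_star_def)
      then have "C \<psi> (assigned k \<nu> \<psi>) = assigned k \<nu> \<psi>"
        by (rule choice_assigned[OF m\<nu> \<psi>]) (use am[OF \<psi>] in auto)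
      moreover have "assigned k \<nu> \<psi> \<subseteq> ?A \<psi> \<union> ?A' \<psi>"
        using \<nu> by auto
      then have "card (C \<psi> (assigned k \<nu> \<psi>)) \<le> card (B \<psi>)"
        using assms(3) \<psi> sub[OF \<psi>] unfolding law_of_aggregate_demand_def B_def by blast
      ultimately show ?thesis
        by simp
    qed
    \<comment> \<open>Both sums count distinct workers, and by \<open>weak\<close> every worker in
      some \<open>B \<psi>\<close> is matched under \<open>\<nu>\<close>, possibly to another firm.
      Only the totals can be compared in this direction.\<close>
    have "(\<Sum>\<psi>\<in>\<Phi>. card (B \<psi>)) = card (\<Union>\<psi>\<in>\<Phi>. B \<psi>)"
      by (rule card_UN_disjoint[symmetric]) (use fin finA disj in auto)
    also have "\<dots> \<le> card (\<Union>\<psi>\<in>\<Phi>. assigned k \<nu> \<psi>)"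
    proof (rule card_mono)
      show "finite (\<Union>\<psi>\<in>\<Phi>. assigned k \<nu> \<psi>)"
        using fin finA by auto
      show "(\<Union>\<psi>\<in>\<Phi>. B \<psi>) \<subseteq> (\<Union>\<psi>\<in>\<Phi>. assigned k \<nu> \<psi>)"
        using weak[OF _ _ \<nu>] by blast
    qed
    also have "\<dots> = (\<Sum>\<psi>\<in>\<Phi>. card (assigned k \<nu> \<psi>))"
      by (rule card_UN_disjoint) (use fin finA assigned_unique[OF m\<nu>] in auto)
    finally show "(\<Sum>\<psi>\<in>\<Phi>. card (B \<psi>)) \<le> (\<Sum>\<psi>\<in>\<Phi>. card (assigned k \<nu> \<psi>))" .
  qed (rule assms(5))
  show ?thesis
    using eq[of \<mu>] eq[of \<mu>'] card_matched_copies[OF m(1) assms(5)]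
      card_matched_copies[OF m(2) assms(5)] by simp
qed

end
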